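(* Let $L\ge 0$ and let $f\in\mathcal C_L$ be an optimal curve for $X$, i.e. $\Delta(f)=G(L)$. Let $$\mathcal A_f=\{x\in\mathbb R^d:\ \mathrm{Card}(\mathcal P_f(x))\ge2\}$$ be its set of ambiguity points. Then: (1) the set $\mathcal A_f$ is measurable; (2) the set $\mathcal A_f$ is negligible for the distribution of $X$, i.e. $\mathbb P(X\in\mathcal A_f)=0$.
   Context: Let $d\ge1$, and let $\mathbb R^d$ carry the Euclidean norm $\|\cdot\|$; $d(x,A)=\inf_{y\in A}\|x-y\|$. Let $X$ be a random vector on a probability space $(\Omega,\mathcal F,\mathbb P)$ with values in $\mathbb R^d$ and $\mathbb E[\|X\|^2]<\infty$. A curve is a continuous function $f:[0,1]\to\mathbb R^d$; its image is $\mathrm{Im} f$ and its length is $\mathscr L(f)=\sup\sum_{i=1}^n\|f(t_i)-f(t_{i-1})\|\in[0,\infty]$, the supremum being over all subdivisions $0=t_0\le\dots\le t_n=1$, $n\ge1$. Set $\Delta(f)=\mathbb E[d(X,\mathrm{Im} f)^2]$. For $L\ge0$, $\mathcal C_L$ denotes either one of the two sets $\{f:[0,1]\to\mathbb R^d \text{ curve},\ \mathscr L(f)\le L\}$ (open case) or $\{f:[0,1]\to\mathbb R^d\text{ curve},\ \mathscr L(f)\le L,\ f(0)=f(1)\}$ (closed case); the result is asserted for each of the two choices. $G(L)=\min\{\Delta(f): f\in\mathcal C_L\}$ (the minimum is attained). For a curve $f$ and $x\in\mathbb R^d$, $\mathcal P_f(x)=\{y\in\mathrm{Im} f:\ \|x-y\|=d(x,\mathrm{Im}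 f)\}$ is the set of projections of $x$ on $\mathrm{Im} f$, and $\mathrm{Card}$ denotes cardinality. *)

theory Defs
  imports "HOL-Probability.Probability"
begin

text \<open>
  A curve is a library \<open>path\<close>, i.e. a function on the reals that is continuous on
  \<open>{0..1}\<close>; its image is \<open>path_image f = f ` {0..1}\<close>, and values outside \<open>{0..1}\<close> play no role.
\<close>

definition curve_length :: "(real \<Rightarrow> 'a::real_normed_vector) \<Rightarrow> ereal" where
  "curve_length f =
     Sup {ereal (\<Sum>i=1..n. norm (f (t i) - f (t (i - 1)))) | (n::nat) (t :: nat \<Rightarrow> real).
            1 \<le> n \<and> t 0 = 0 \<and> t n = 1 \<and> (\<forall>i\<in>{1..n}. t (i - 1) \<le> t i)}"

definition open_curves :: "real \<Rightarrow> (real \<Rightarrow> 'a::real_normed_vector) set" where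
  "open_curves L = {f. path f \<and> curve_length f \<le> ereal L}"

definition closed_curves :: "real \<Rightarrow> (real \<Rightarrow> 'a::real_normed_vector) set" where
  "closed_curves L = {f. path f \<and> curve_length f \<le> ereal L \<and> f 0 = f 1}"

text \<open>
  The expectation is a Bochner integral; it is a genuine (finite) value for every curve as soon as
  \<open>X\<close> is measurable and square integrable.
\<close>

definition distortion ::
    "'w measure \<Rightarrow> ('w \<Rightarrow> 'a::real_normed_vector) \<Rightarrow> (real \<Rightarrow> 'a) \<Rightarrow> real" where
  "distortion M X f = (LINT \<omega>|M. (infdist (X \<omega>) (path_image f))\<^sup>2)"

text \<open>
  The infimum is over a nonempty set of nonnegative reals (constant curves are admissible for
  \<open>L \<ge> 0\<close>), so it is the minimum whenever it is attained; in particular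
  \<open>distortion M X f = min_distortion M X C\<close> with \<open>f \<in> C\<close> says that \<open>f\<close> attains the minimum.
\<close>

definition min_distortion ::
    "'w measure \<Rightarrow> ('w \<Rightarrow> 'a::real_normed_vector) \<Rightarrow> (real \<Rightarrow> 'a) set \<Rightarrow> real" where
  "min_distortion M X C = (INF f\<in>C. distortion M X f)"

definition projections :: "(real \<Rightarrow> 'a::real_normed_vector) \<Rightarrow> 'a \<Rightarrow> 'a set" where
  "projections f x = {y \<in> path_image f. norm (x - y) = infdist x (path_image f)}"

text \<open>
  The first disjunct is needed because \<open>card\<close> is 0 on infinite sets, and the set of projections
  may be infinite.
\<close>

definition ambiguity_points :: "(real \<Rightarrow> 'a::real_normed_vector) \<Rightarrow> 'a set" where
  "ambiguity_points f = {x. infinite (projections f x) \<or> 2 \<le> card (projections f x)}"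

end

theory Submission
  imports Defs
begin

text \<open>
  The admissible classes are stable under translation, and translations alone force the result.
  Translating \<open>f\<close> by \<open>v\<close> amounts to replacing \<open>X\<close> by \<open>X - v\<close>, so optimality of \<open>f\<close> says that
  \<open>v \<mapsto> \<E> (D (X + v))\<close> is minimal at \<open>v = 0\<close>, where \<open>D\<close> is the squared distance to the image of
  \<open>f\<close>. But \<open>D\<close> has a concave kink at every ambiguity point \<open>x\<close>: if \<open>y\<close> and \<open>z\<close> are two
  projections of \<open>x\<close>, then bounding \<open>D (x + v)\<close> with \<open>y\<close> and \<open>D (x - v)\<close> with \<open>z\<close> gives
  \<open>D (x + v) + D (x - v) \<le> 2 * D x + 2 * \<parallel>v\<parallel>\<^sup>2 - 2 * (v \<bullet> (y - z))\<close>
  (lemma \<open>sq_infdist_symmetric_diff\<close>). For \<open>v = \<epsilon> e\<close> the last term is of first order in \<open>\<epsilon>\<close>, the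
  penalty \<open>2 * \<parallel>v\<parallel>\<^sup>2\<close> only of second order. Hence, if the kinks in the direction \<open>e\<close> had positive
  probability, one of the two translations by \<open>\<plusminus> \<epsilon> e\<close> would strictly decrease the criterion for
  small \<open>\<epsilon>\<close>.

  To make this quantitative and to obtain measurability at the same time, the ambiguity points
  are split according to a coordinate direction \<open>e\<close> and a lower bound \<open>r > 0\<close> on the extent of the
  projection set along \<open>e\<close>. Each piece is closed because the image of \<open>f\<close> is compact, countably
  many pieces suffice, and each is negligible by the argument above.
\<close>

section \<open>Ambiguity points as a countable union of closed sets\<close>

definition wide_points ::
    "(real \<Rightarrow> 'a::real_inner) \<Rightarrow> 'a \<Rightarrow> real \<Rightarrow> 'a set" where
  "wide_points f e r = {x. \<exists>y\<in>projections f x. \<exists>z\<in>projections f x. r \<le> e \<bullet> (y - z)}"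

lemma ambiguity_points_iff:
  "x \<in> ambiguity_points f \<longleftrightarrow> (\<exists>y\<in>projections f x. \<exists>z\<in>projections f x. y \<noteq> z)"
proof (cases "finite (projections f x)")
  case True
  then show ?thesis
    using card_le_Suc0_iff_eq[OF True] by (auto simp: ambiguity_points_def)
next
  case False
  then have "\<not> projections f x \<subseteq> {y}" for y
    using finite_subset by blast
  moreover obtain y where "y \<in> projections f x"
    using False by (metis ex_in_conv finite.emptyI)
  ultimately have "\<exists>y\<in>projections f x. \<exists>z\<in>projections f x. y \<noteq> z"
    by blast
  with False show ?thesis
    by (simp add: ambiguity_points_def)
qed

text \<open>
  A limit of wide points is wide because the two witnesses range over a compact set, so they
  can be chosen to converge along with the points.
\<close>

lemma closed_wide_points:
  fixes f :: "real \<Rightarrow> 'a::euclidean_space"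
  assumes "path f"
  shows "closed (wide_points f e r)"
  unfolding closed_sequential_limits
proof (intro allI impI, elim conjE)
  fix x l assume x: "\<forall>n. x n \<in> wide_points f e r" and lim: "x \<longlonglongrightarrow> l"
  let ?K = "path_image f"
  obtain y z where y: "\<And>n. y n \<in> projections f (x n)" and z: "\<And>n. z n \<in> projections f (x n)"
    and r: "\<And>n. r \<le> e \<bullet> (y n - z n)"
    using x unfolding wide_points_def by (simp add: Bex_def) metis
  have "compact (?K \<times> ?K)"
    using assms by (intro compact_Times compact_path_image)
  moreover have "\<forall>n. (y n, z n) \<in> ?K \<times> ?K"
    using y z by (auto simp: projections_def)
  ultimately obtain p s where p: "p \<in> ?K \<times> ?K" and s: "strict_mono s"
    and conv: "((\<lambda>n. (y n, z n)) \<circ> s) \<longlonglongrightarrow> p"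
    unfolding compact_def by meson
  have ylim: "(\<lambda>n. y (s n)) \<longlonglongrightarrow> fst p" and zlim: "(\<lambda>n. z (s n)) \<longlonglongrightarrow> snd p"
    using tendsto_fst[OF conv] tendsto_snd[OF conv] by (simp_all add: o_def)
  have xlim: "(\<lambda>n. x (s n)) \<longlonglongrightarrow> l"
    using LIMSEQ_subseq_LIMSEQ[OF lim s] by (simp add: o_def)
  have "(\<lambda>n. norm (x (s n) - w (s n))) \<longlonglongrightarrow> norm (l - c) \<Longrightarrow>
        (\<And>n. w n \<in> projections f (x n)) \<Longrightarrow> norm (l - c) = infdist l ?K" for w c
    using LIMSEQ_unique[of _ "norm (l - c)" "infdist l ?K"] tendsto_infdist[OF xlim, of ?K]
    by (simp add: projections_def)
  then have "fst p \<in> projections f l" "snd p \<in> projections f l"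
    using p y z tendsto_norm[OF tendsto_diff[OF xlim ylim]]
      tendsto_norm[OF tendsto_diff[OF xlim zlim]]
    by (auto simp: projections_def)
  moreover have "r \<le> e \<bullet> (fst p - snd p)"
    by (rule LIMSEQ_le_const[of "\<lambda>n. e \<bullet> (y (s n) - z (s n))"])
       (use r in \<open>auto intro!: tendsto_intros ylim zlim\<close>)
  ultimately show "l \<in> wide_points f e r"
    unfolding wide_points_def by blast
qed

lemma ambiguity_points_eq_Union_wide_points:
  fixes f :: "real \<Rightarrow> 'a::euclidean_space"
  shows "ambiguity_points f = (\<Union>e\<in>Basis. \<Union>n. wide_points f e (inverse (real (Suc n))))"
proof (rule set_eqI, rule iffI)
  fix x assume "x \<in> ambiguity_points f"
  then obtain y z where yz: "y \<in> projections f x" "z \<in> projections f x" "y \<noteq> z"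
    unfolding ambiguity_points_iff by blast
  then obtain e where e: "e \<in> Basis" "e \<bullet> y \<noteq> e \<bullet> z"
    using euclidean_eqI[of y z] by (metis inner_commute)
  obtain u v where uv: "u \<in> projections f x" "v \<in> projections f x" "0 < e \<bullet> (u - v)"
    using yz e(2) by (cases "e \<bullet> y" "e \<bullet> z" rule: linorder_cases) (auto simp: inner_diff_right)
  obtain n where "inverse (real (Suc n)) < e \<bullet> (u - v)"
    using reals_Archimedean[OF uv(3)] by blast
  then have "x \<in> wide_points f e (inverse (real (Suc n)))"
    using uv(1,2) unfolding wide_points_def by (blast intro: less_imp_le)
  then show "x \<in> (\<Union>e\<in>Basis. \<Union>n. wide_points f e (inverse (real (Suc n))))"
    using e(1) by blast
next
  fix x assume "x \<in> (\<Union>e\<in>Basis. \<Union>n. wide_points f e (inverse (real (Suc n))))"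
  then obtain e n y z where "y \<in> projections f x" "z \<in> projections f x"
      and le: "inverse (real (Suc n)) \<le> e \<bullet> (y - z)"
    unfolding wide_points_def by blast
  moreover have "y \<noteq> z"
    using le by (auto simp: field_simps)
  ultimately show "x \<in> ambiguity_points f"
    unfolding ambiguity_points_iff by blast
qed

section \<open>Translations of an admissible curve\<close>

lemma translate_admissible:
  assumes "C = open_curves L \<or> C = closed_curves L" and "f \<in> C"
  shows "(\<lambda>t. v + f t) \<in> C"
proof -
  have path: "path (\<lambda>t. v + f t)" if "path f"
    using that unfolding path_def by (rule continuous_on_add[OF continuous_on_const])
  have "curve_length (\<lambda>t. v + f t) = curve_length f"
    unfolding curve_length_def add_diff_cancel_left ..
  with assms path show ?thesis
    unfolding open_curves_def closed_curves_def by fastforce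
qed

lemma infdist_translation:
  fixes x :: "'a::real_normed_vector"
  shows "infdist x ((+) v ` A) = infdist (x - v) A"
proof -
  have "dist x (v + y) = dist (x - v) y" for y
    by (simp add: dist_norm diff_diff_add)
  then show ?thesis
    by (simp only: infdist_def image_image image_is_empty)
qed

lemma distortion_translate:
  "distortion M X (\<lambda>t. v + f t) = (LINT \<omega>|M. (infdist (X \<omega> - v) (path_image f))\<^sup>2)"
proof -
  have "path_image (\<lambda>t. v + f t) = (+) v ` path_image f"
    by (simp add: path_image_def image_image)
  then show ?thesis
    by (simp add: distortion_def infdist_translation)
qed

lemma min_distortion_le:
  "g \<in> C \<Longrightarrow> min_distortion M X C \<le> distortion M X g"
  unfolding min_distortion_def
  by (intro cINF_lower bdd_belowI2[where m = 0]) (simp_all add: distortion_def)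

section \<open>Second differences of the squared distance\<close>

lemma sq_infdist_shift:
  fixes x v y :: "'a::real_inner"
  assumes "y \<in> projections f x"
  shows "(infdist (x + v) (path_image f))\<^sup>2
    \<le> (infdist x (path_image f))\<^sup>2 + 2 * (v \<bullet> (x - y)) + (norm v)\<^sup>2"
proof -
  have "infdist (x + v) (path_image f) \<le> norm (x + v - y)"
    using assms infdist_le[of y "path_image f" "x + v"]
    by (simp add: projections_def dist_norm)
  then have "(infdist (x + v) (path_image f))\<^sup>2 \<le> (norm (x + v - y))\<^sup>2"
    by (intro power_mono) (auto simp: infdist_nonneg)
  also have "\<dots> = (norm (x - y))\<^sup>2 + 2 * (v \<bullet> (x - y)) + (norm v)\<^sup>2"
    unfolding power2_norm_eq_inner by (simp add: algebra_simps inner_commute)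
  finally show ?thesis
    using assms by (simp add: projections_def)
qed

text \<open>
  The kink: using different projections for the two opposite shifts leaves the first-order term
  \<open>v \<bullet> (y - z)\<close>. Taking \<open>y = z\<close> gives the bound that holds at every point.
\<close>

lemma sq_infdist_symmetric_diff:
  fixes x v y z :: "'a::real_inner"
  assumes "y \<in> projections f x" and "z \<in> projections f x"
  shows "(infdist (x + v) (path_image f))\<^sup>2 + (infdist (x - v) (path_image f))\<^sup>2
    \<le> 2 * (infdist x (path_image f))\<^sup>2 + 2 * (norm v)\<^sup>2 - 2 * (v \<bullet> (y - z))"
  using sq_infdist_shift[OF assms(1), of v] sq_infdist_shift[OF assms(2), of "- v"]
  by (simp add: inner_diff_right)

lemma projections_nonempty:
  fixes f :: "real \<Rightarrow> 'a::euclidean_space"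
  assumes "path f"
  shows "\<exists>y. y \<in> projections f x"
proof -
  obtain y where "y \<in> path_image f" "infdist x (path_image f) = dist x y"
    using assms by (rule infdist_attains_inf[OF closed_path_image path_image_nonempty])
  then show ?thesis
    by (intro exI[of _ y]) (simp add: projections_def dist_norm)
qed

lemma sq_infdist_symmetric_diff_wide:
  fixes f :: "real \<Rightarrow> 'a::euclidean_space"
  assumes "path f" and "0 \<le> \<epsilon>"
  shows "(infdist (x + \<epsilon> *\<^sub>R e) (path_image f))\<^sup>2 + (infdist (x - \<epsilon> *\<^sub>R e) (path_image f))\<^sup>2
    \<le> 2 * (infdist x (path_image f))\<^sup>2 + 2 * (\<epsilon> * norm e)\<^sup>2
      - 2 * \<epsilon> * r * indicator (wide_points f e r) x"
proof (cases "x \<in> wide_points f e r")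
  case True
  then obtain y z where yz: "y \<in> projections f x" "z \<in> projections f x" "r \<le> e \<bullet> (y - z)"
    unfolding wide_points_def by blast
  have "\<epsilon> * r \<le> \<epsilon> * (e \<bullet> (y - z))"
    using yz(3) assms(2) by (rule mult_left_mono)
  then show ?thesis
    using sq_infdist_symmetric_diff[OF yz(1,2), of "\<epsilon> *\<^sub>R e"] True
    by (simp add: power_mult_distrib)
next
  case False
  obtain y where "y \<in> projections f x"
    using projections_nonempty[OF assms(1)] by blast
  from sq_infdist_symmetric_diff[OF this this, of "\<epsilon> *\<^sub>R e"] show ?thesis
    using False by (simp add: power_mult_distrib)
qed

section \<open>Negligibility\<close>

lemma integrable_sq_infdist:
  fixes X :: "'w \<Rightarrow> 'a::euclidean_space"
  assumes "prob_space M" and X[measurable]: "X \<in> borel_measurable M"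
    and int: "integrable M (\<lambda>\<omega>. (norm (X \<omega>))\<^sup>2)" and "A \<noteq> {}"
  shows "integrable M (\<lambda>\<omega>. (infdist (X \<omega> + v) A)\<^sup>2)"
proof -
  interpret prob_space M by fact
  obtain a where a: "a \<in> A" using assms(4) by blast
  have bound: "(infdist (x + v) A)\<^sup>2 \<le> 2 * (norm x)\<^sup>2 + 2 * (norm (v - a))\<^sup>2" for x
  proof -
    have "infdist (x + v) A \<le> norm (x + (v - a))"
      using infdist_le[OF a, of "x + v"] by (simp add: dist_norm add_diff_eq)
    also have "\<dots> \<le> norm x + norm (v - a)"
      by (rule norm_triangle_ineq)
    finally have "(infdist (x + v) A)\<^sup>2 \<le> (norm x + norm (v - a))\<^sup>2"
      by (intro power_mono) (auto simp: infdist_nonneg)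
    also have "\<dots> \<le> 2 * (norm x)\<^sup>2 + 2 * (norm (v - a))\<^sup>2"
      using sum_squares_bound[of "norm x" "norm (v - a)"] by (simp add: power2_sum)
    finally show ?thesis .
  qed
  have "integrable M (\<lambda>\<omega>. 2 * (norm (X \<omega>))\<^sup>2 + 2 * (norm (v - a))\<^sup>2)"
    using int by simp
  then show ?thesis
  proof (rule Bochner_Integration.integrable_bound)
    have [measurable]: "(\<lambda>x. infdist x A) \<in> borel_measurable borel"
      by (intro borel_measurable_continuous_onI continuous_on_infdist continuous_on_id)
    show "(\<lambda>\<omega>. (infdist (X \<omega> + v) A)\<^sup>2) \<in> borel_measurable M"
      by measurable
  qed (use bound in \<open>auto intro!: AE_I2\<close>)
qed

text \<open>
  Averaging the second difference over \<open>X\<close>: by minimality under translations the left-hand side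
  of \<open>sq_infdist_symmetric_diff_wide\<close> has expectation at least that of \<open>2 * D\<close>, so
  \<open>r * \<P>(X \<in> wide_points f e r)\<close> is at most of order \<open>\<epsilon>\<close>, for every \<open>\<epsilon> > 0\<close>.
\<close>

lemma measure_wide_points_eq_0:
  fixes X :: "'w \<Rightarrow> 'a::euclidean_space"
  assumes "prob_space M" and X[measurable]: "X \<in> borel_measurable M"
    and int: "integrable M (\<lambda>\<omega>. (norm (X \<omega>))\<^sup>2)"
    and f: "path f"
    and opt: "\<And>v. distortion M X f \<le> distortion M X (\<lambda>t. v + f t)"
    and r: "0 < r"
  shows "measure M {\<omega> \<in> space M. X \<omega> \<in> wide_points f e r} = 0"
proof -
  interpret prob_space M by fact
  define D where "D x = (infdist x (path_image f))\<^sup>2" for x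
  have [measurable]: "wide_points f e r \<in> sets borel"
    using closed_wide_points[OF f] by (rule borel_closed)
  define p where "p = prob {\<omega> \<in> space M. X \<omega> \<in> wide_points f e r}"
  have D_int: "integrable M (\<lambda>\<omega>. D (X \<omega> + v))" for v
    unfolding D_def using integrable_sq_infdist[OF assms(1-3)] by simp
  have D_int': "integrable M (\<lambda>\<omega>. D (X \<omega> - v))" for v
    using D_int[of "- v"] by simp
  have D_int0: "integrable M (\<lambda>\<omega>. D (X \<omega>))"
    using D_int[of 0] by simp
  have D_min: "expectation (\<lambda>\<omega>. D (X \<omega>)) \<le> expectation (\<lambda>\<omega>. D (X \<omega> - v))" for v
    using opt[of v] unfolding distortion_translate by (simp add: distortion_def D_def)
  have "r * p \<le> \<epsilon> * (norm e)\<^sup>2" if "0 < \<epsilon>" for \<epsilon>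
  proof -
    let ?v = "\<epsilon> *\<^sub>R e"
    let ?I = "\<lambda>\<omega>. indicator (wide_points f e r) (X \<omega>) :: real"
    have I_int: "integrable M ?I"
      by (rule integrable_const_bound[where B = 1]) (auto simp: indicator_def)
    have "expectation ?I = expectation (indicator {\<omega> \<in> space M. X \<omega> \<in> wide_points f e r})"
      by (intro Bochner_Integration.integral_cong) (auto simp: indicator_def)
    then have I_exp: "expectation ?I = p"
      by (simp add: p_def)
    have "2 * expectation (\<lambda>\<omega>. D (X \<omega>))
        \<le> expectation (\<lambda>\<omega>. D (X \<omega> + ?v)) + expectation (\<lambda>\<omega>. D (X \<omega> - ?v))"
      using D_min[of ?v] D_min[of "- ?v"] by simp
    also have "\<dots> = expectation (\<lambda>\<omega>. D (X \<omega> + ?v) + D (X \<omega> - ?v))"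
      using D_int D_int' by simp
    also have "\<dots> \<le> expectation (\<lambda>\<omega>. 2 * D (X \<omega>) + 2 * (\<epsilon> * norm e)\<^sup>2 - 2 * \<epsilon> * r * ?I \<omega>)"
    proof (rule integral_mono)
      show "D (X \<omega> + ?v) + D (X \<omega> - ?v)
          \<le> 2 * D (X \<omega>) + 2 * (\<epsilon> * norm e)\<^sup>2 - 2 * \<epsilon> * r * ?I \<omega>" for \<omega>
        using sq_infdist_symmetric_diff_wide[OF f, of \<epsilon> "X \<omega>" e r] that
        by (simp add: D_def)
    qed (use D_int D_int' D_int0 I_int in simp_all)
    also have "\<dots> = 2 * expectation (\<lambda>\<omega>. D (X \<omega>)) + 2 * (\<epsilon> * norm e)\<^sup>2 - 2 * \<epsilon> * r * p"
      using D_int0 I_int by (simp add: I_exp prob_space)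
    finally have "\<epsilon> * (r * p) \<le> \<epsilon> * (\<epsilon> * (norm e)\<^sup>2)"
      by (simp add: power2_eq_square algebra_simps)
    then show ?thesis
      using that by simp
  qed
  moreover have "((\<lambda>\<epsilon>. \<epsilon> * (norm e)\<^sup>2) \<longlongrightarrow> 0 * (norm e)\<^sup>2) (at_right 0)"
    by (intro tendsto_mult tendsto_const tendsto_ident_at)
  ultimately have "r * p \<le> 0 * (norm e)\<^sup>2"
    by (intro tendsto_lowerbound[where F = "at_right 0" and f = "\<lambda>\<epsilon>. \<epsilon> * (norm e)\<^sup>2"])
       (auto intro: eventually_at_rightI[of 0 1])
  moreover have "0 \<le> p"
    by (simp add: p_def)
  ultimately show ?thesis
    using r unfolding p_def[symmetric] by (simp add: mult_le_0_iff)
qed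

theorem proposition3p1:
  fixes M :: "'w measure"
    and X :: "'w \<Rightarrow> real ^ 'd::finite"
    and L :: real
    and C :: "(real \<Rightarrow> real ^ 'd) set"
    and f :: "real \<Rightarrow> real ^ 'd"
  assumes "prob_space M"
    and "X \<in> borel_measurable M"
    and "integrable M (\<lambda>\<omega>. (norm (X \<omega>))\<^sup>2)"
    and "L \<ge> 0"
    and "C = open_curves L \<or> C = closed_curves L"
    and "f \<in> C"
    and "distortion M X f = min_distortion M X C"
  shows "ambiguity_points f \<in> sets borel
    \<and> measure M {\<omega> \<in> space M. X \<omega> \<in> ambiguity_points f} = 0"
proof -
  interpret prob_space M by fact
  note [measurable] = assms(2)
  have f: "path f"
    using assms(5,6) by (auto simp: open_curves_def closed_curves_def)
  have opt: "distortion M X f \<le> distortion M X (\<lambda>t. v + f t)" for v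
    using min_distortion_le[OF translate_admissible[OF assms(5,6)]] assms(7) by simp
  have wide[measurable]: "wide_points f e r \<in> sets borel" for e r
    using closed_wide_points[OF f] by (rule borel_closed)
  have meas: "ambiguity_points f \<in> sets borel"
    unfolding ambiguity_points_eq_Union_wide_points by (auto intro: countable_finite)
  have "AE \<omega> in M. X \<omega> \<notin> wide_points f e (inverse (real (Suc n)))" for e n
  proof -
    have "prob {\<omega> \<in> space M. X \<omega> \<in> wide_points f e (inverse (real (Suc n)))} = 0"
      by (rule measure_wide_points_eq_0[OF assms(1-3) f opt]) simp
    then show ?thesis
      by (subst (asm) prob_eq_0) auto
  qed
  then have "AE \<omega> in M. \<forall>e\<in>Basis. \<forall>n. X \<omega> \<notin> wide_points f e (inverse (real (Suc n)))"
    by (simp add: AE_ball_countable AE_all_countable countable_finite)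
  then have "AE \<omega> in M. X \<omega> \<notin> ambiguity_points f"
    unfolding ambiguity_points_eq_Union_wide_points by simp
  then have "prob {\<omega> \<in> space M. X \<omega> \<in> ambiguity_points f} = 0"
    using meas by (subst prob_eq_0) auto
  with meas show ?thesis ..
qed

end
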